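(* If $p>2$, $a>0$ and $0<r<s<\infty$ are real numbers, then the compact arc $$\Gamma_{p,a}[r,s]=\{(ay^p,y):r\le y\le s\}\subset\mathbb{R}^2$$ is a nonconic real-analytic rectifiable arc every five distinct points of which determine a nondegenerate hyperbola.
   Context: A conic in the real plane with affine coordinates $(u,y)$ is given by an equation $F+Ey+Cy^2+Du+Buy+Au^2=0$ with real coefficients not all zero, two equations being identified if they are proportional. An arc is nonconic if it is not contained in any conic. The conic is nondegenerate if the associated symmetric $3\times3$ matrix of its homogenization is nonsingular. With discriminant $\Delta=B^2-4AC$, a nondegenerate hyperbola is a nondegenerate conic with $\Delta>0$. Five points determine a nondegenerate hyperbola if there is a unique conic (up to a nonzero scalar multiple of its equation) through them and it is a nondegenerate hyperbola. *)

theory Defs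
  imports "HOL-Analysis.Analysis"
begin

section \<open>Conics\<close>

text \<open>
  A point of the plane is a pair \<open>(u, y)\<close>. The tuple \<open>(A, B, C, D, E, F)\<close> stands for the equation
  \<open>F + E y + C y\<^sup>2 + D u + B u y + A u\<^sup>2 = 0\<close>, so that rescaling an equation is scalar
  multiplication in the product vector space. A conic is the class of a nonzero tuple up to
  proportionality; every predicate below that refers to a conic through such a tuple is invariant
  under nonzero rescaling.
\<close>

type_synonym conic_eqn = "real \<times> real \<times> real \<times> real \<times> real \<times> real"

definition is_conic :: "conic_eqn \<Rightarrow> bool" where
  "is_conic q \<longleftrightarrow> q \<noteq> 0"

definition same_conic :: "conic_eqn \<Rightarrow> conic_eqn \<Rightarrow> bool" where
  "same_conic q q' \<longleftrightarrow> (\<exists>k::real. k \<noteq> 0 \<and> q' = k *\<^sub>R q)"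

fun conic_points :: "conic_eqn \<Rightarrow> (real \<times> real) set" where
  "conic_points (A, B, C, D, E, F) =
     {(u, y). F + E * y + C * y\<^sup>2 + D * u + B * u * y + A * u\<^sup>2 = 0}"

text \<open>
  The symmetric matrix of the homogenization
  \<open>A u\<^sup>2 + B u y + C y\<^sup>2 + D u w + E y w + F w\<^sup>2\<close>, with the variables ordered \<open>u, y, w\<close>.
\<close>

fun conic_matrix :: "conic_eqn \<Rightarrow> real^3^3" where
  "conic_matrix (A, B, C, D, E, F) =
     vector [vector [A,     B / 2, D / 2],
             vector [B / 2, C,     E / 2],
             vector [D / 2, E / 2, F]]"

fun conic_discriminant :: "conic_eqn \<Rightarrow> real" where
  "conic_discriminant (A, B, C, D, E, F) = B\<^sup>2 - 4 * A * C"

definition nondegenerate_conic :: "conic_eqn \<Rightarrow> bool" where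
  "nondegenerate_conic q \<longleftrightarrow> is_conic q \<and> invertible (conic_matrix q)"

definition nondegenerate_hyperbola :: "conic_eqn \<Rightarrow> bool" where
  "nondegenerate_hyperbola q \<longleftrightarrow> nondegenerate_conic q \<and> conic_discriminant q > 0"

definition determines_nondegenerate_hyperbola :: "(real \<times> real) set \<Rightarrow> bool" where
  "determines_nondegenerate_hyperbola P \<longleftrightarrow>
     (\<exists>q. is_conic q \<and> P \<subseteq> conic_points q \<and>
          (\<forall>q'. is_conic q' \<and> P \<subseteq> conic_points q' \<longrightarrow> same_conic q q') \<and>
          nondegenerate_hyperbola q)"

definition nonconic :: "(real \<times> real) set \<Rightarrow> bool" where
  "nonconic S \<longleftrightarrow> \<not> (\<exists>q. is_conic q \<and> S \<subseteq> conic_points q)"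


section \<open>Real-analytic and rectifiable arcs\<close>

definition real_analytic_at :: "(real \<Rightarrow> 'a::real_normed_vector) \<Rightarrow> real \<Rightarrow> bool" where
  "real_analytic_at f x \<longleftrightarrow>
     (\<exists>c :: nat \<Rightarrow> 'a. \<exists>e>0. \<forall>h. \<bar>h\<bar> < e \<longrightarrow> (\<lambda>n. h ^ n *\<^sub>R c n) sums f (x + h))"

text \<open>
  An arc, as a set, is the image of an injective path on \<open>[0, 1]\<close>. It is real-analytic if the
  path can be chosen real-analytic (on a neighbourhood of \<open>[0, 1]\<close>) and regular; without
  regularity, sets with cusps such as \<open>{(t\<^sup>2, t\<^sup>3). \<bar>t\<bar> \<le> 1}\<close> would qualify.
\<close>

definition real_analytic_arc :: "'a::real_normed_vector set \<Rightarrow> bool" where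
  "real_analytic_arc S \<longleftrightarrow>
     (\<exists>g. arc g \<and> path_image g = S \<and>
          (\<forall>t\<in>{0..1}. real_analytic_at g t) \<and>
          (\<forall>t\<in>{0..1}. \<exists>v. v \<noteq> 0 \<and> (g has_vector_derivative v) (at t)))"

definition finite_length :: "(real \<Rightarrow> 'a::metric_space) \<Rightarrow> bool" where
  "finite_length g \<longleftrightarrow>
     bdd_above {(\<Sum>i<n. dist (g (t i)) (g (t (Suc i)))) | (n::nat) (t::nat \<Rightarrow> real).
                  (\<forall>i\<le>n. t i \<in> {0..1}) \<and> mono_on {..n} t}"

text \<open>The length of an arc does not depend on the choice of the injective path.\<close>

definition rectifiable_arc :: "'a::metric_space set \<Rightarrow> bool" where
  "rectifiable_arc S \<longleftrightarrow> (\<exists>g. arc g \<and> path_image g = S \<and> finite_length g)"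


section \<open>Power arcs\<close>

definition power_arc :: "real \<Rightarrow> real \<Rightarrow> real \<Rightarrow> real \<Rightarrow> (real \<times> real) set" where
  "power_arc p a r s = {(a * y powr p, y) | y. r \<le> y \<and> y \<le> s}"

end

theory Submission
  imports Defs
begin

text \<open>
  On the curve \<open>u = a y\<^sup>p\<close> the equation of a conic becomes a real combination of the six powers
  of \<open>y\<close> with exponents \<open>0 < 1 < 2 < p < p + 1 < 2p\<close>. By Rolle's theorem (the easy half of
  Descartes' rule of signs for real exponents), a combination of \<open>m + 1\<close> powers with \<open>m\<close>
  distinct positive zeros either vanishes identically or has coefficients of strictly alternating
  signs. Hence the conic through five points is unique, and its coefficients satisfy \<open>A C < 0\<close>,
  so that its discriminant is positive. Were it degenerate, it would split into two real lines,
  each meeting the curve in at most two points.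
\<close>

section \<open>Sign alternation for sums of real powers\<close>

text \<open>Induction on the largest zero \<open>b\<close>: the mean value theorem gives one further
  zero of \<open>f'\<close> between \<open>Max A\<close> and \<open>b\<close>. The bound by
  \<open>Max Z\<close> is carried along so that this zero differs from those already found.\<close>

lemma Rolle_card_zeros:
  fixes f f' :: "real \<Rightarrow> real"
  assumes deriv: "\<And>y. y > 0 \<Longrightarrow> (f has_real_derivative f' y) (at y)"
    and "finite Z" "card Z = Suc m" "Z \<subseteq> {0<..}" "\<forall>y\<in>Z. f y = 0"
  shows "\<exists>Z'. finite Z' \<and> card Z' = m \<and> Z' \<subseteq> {0<..<Max Z} \<and> (\<forall>y\<in>Z'. f' y = 0)"
  using assms(2-)
proof (induction Z arbitrary: m rule: finite_linorder_max_induct)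
  case empty
  then show ?case by simp
next
  case (insert b A)
  show ?case
  proof (cases m)
    case 0
    then show ?thesis by (intro exI[of _ "{}"]) auto
  next
    case (Suc k)
    have "b \<notin> A" using insert.hyps by auto
    with insert.prems insert.hyps Suc have cA: "card A = Suc k" by simp
    then have ne: "A \<noteq> {}" by auto
    obtain Z' where Z': "finite Z'" "card Z' = k" "Z' \<subseteq> {0<..<Max A}" "\<forall>y\<in>Z'. f' y = 0"
      using insert.IH[OF cA] insert.prems by auto
    have MA: "Max A \<in> A" using ne insert.hyps by simp
    then have lt: "Max A < b" and pos: "Max A > 0" and z: "f (Max A) = 0" "f b = 0"
      using insert by auto
    have "\<exists>z. Max A < z \<and> z < b \<and> f b - f (Max A) = (b - Max A) * f' z"
      using lt pos by (intro MVT2) (auto intro!: deriv)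
    then obtain z where z': "Max A < z" "z < b" "f' z = 0"
      using z lt by auto
    have "Max (insert b A) = b"
      using insert.hyps by (intro Max_eqI) (auto intro: less_imp_le)
    moreover have "z \<notin> Z'" using Z' z' by auto
    ultimately show ?thesis
      using Z' z' pos lt Suc by (intro exI[of _ "insert z Z'"]) fastforce
  qed
qed

text \<open>Dividing by \<open>y powr \<alpha>\<close> keeps the positive zeros, Rolle's theorem
  costs one of them, and multiplying the derivative by \<open>y powr (\<alpha> + 1)\<close> restores
  the exponents. If \<alpha> is one of the exponents, its term drops out.\<close>

lemma powr_sum_reduce_zeros:
  fixes c e :: "nat \<Rightarrow> real" and \<alpha> :: real
  assumes "finite Z" "card Z = Suc m" "Z \<subseteq> {0<..}"
    and "\<forall>y\<in>Z. (\<Sum>i\<in>I. c i * y powr e i) = 0"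
  obtains Z' where "finite Z'" "card Z' = m" "Z' \<subseteq> {0<..}"
    "\<forall>y\<in>Z'. (\<Sum>i\<in>I. (c i * (e i - \<alpha>)) * y powr e i) = 0"
proof -
  define f where "f y = (\<Sum>i\<in>I. c i * y powr (e i - \<alpha>))" for y
  define f' where "f' y = (\<Sum>i\<in>I. c i * ((e i - \<alpha>) * y powr (e i - \<alpha> - 1)))" for y
  have d: "(f has_real_derivative f' y) (at y)" if "y > 0" for y
    unfolding f_def f'_def using that by (auto intro!: derivative_eq_intros sum.cong)
  have f: "f y = (\<Sum>i\<in>I. c i * y powr e i) * y powr - \<alpha>" if "y > 0" for y
    unfolding f_def sum_distrib_right
    by (intro sum.cong refl) (simp add: powr_add[symmetric])
  have f': "(\<Sum>i\<in>I. (c i * (e i - \<alpha>)) * y powr e i) = f' y * y powr (\<alpha> + 1)" if "y > 0" for y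
    unfolding f'_def sum_distrib_right
    by (intro sum.cong refl) (simp add: powr_add[symmetric])
  have "\<forall>y\<in>Z. f y = 0" using assms(3,4) f by auto
  from Rolle_card_zeros[of f f', OF d assms(1-3) this] obtain Z' where
    "finite Z'" "card Z' = m" "Z' \<subseteq> {0<..<Max Z}" "\<forall>y\<in>Z'. f' y = 0" by auto
  then show thesis using f' by (intro that[of Z']) auto
qed

text \<open>Induction on \<open>m\<close>, removing once the lowest and once the highest term. The
  factors picked up on the way have constant sign, so each shorter sum passes its alternative on to
  the original coefficients; together the two cover all neighbouring pairs.\<close>

lemma powr_sum_sign_alternation:
  fixes c e :: "nat \<Rightarrow> real"
  assumes "strict_mono_on {..m} e"
    and "finite Z" "card Z = m" "Z \<subseteq> {0<..}"
    and "\<forall>y\<in>Z. (\<Sum>i\<le>m. c i * y powr e i) = 0"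
  shows "(\<forall>i\<le>m. c i = 0) \<or> (\<forall>i<m. c i * c (Suc i) < 0)"
  using assms
proof (induction m arbitrary: c e Z)
  case 0
  then show ?case by simp
next
  case (Suc m)
  have less: "e i < e j" if "i < j" "j \<le> Suc m" for i j
    using Suc.prems(1) that by (auto simp: strict_mono_on_def)
  show ?case
  proof (cases "m = 0")
    \<comment> \<open>With only two terms the two shorter sums share no coefficient, so nothing
      would link their alternatives; the single equation is solved for \<open>c 0\<close>
      instead.\<close>
    case True
    with Suc.prems obtain y where y: "y > 0" "c 0 * y powr e 0 + c 1 * y powr e 1 = 0"
      by (auto simp: card_1_singleton_iff)
    have c0: "c 0 = - c 1 * (y powr e 1 / y powr e 0)" using y by (simp add: field_simps)
    have "c 0 * c 1 = - ((c 1)\<^sup>2 * (y powr e 1 / y powr e 0))"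
      unfolding c0 by (simp add: power2_eq_square)
    moreover have "(c 1)\<^sup>2 * (y powr e 1 / y powr e 0) > 0" if "c 1 \<noteq> 0"
      using y that by simp
    ultimately have "c 0 * c 1 < 0" if "c 1 \<noteq> 0" using that by linarith
    moreover have "c 0 = 0" if "c 1 = 0" using c0 that by simp
    ultimately show ?thesis using True by (auto simp: le_Suc_eq)
  next
    case False
    \<comment> \<open>The choices \<open>\<alpha> = e 0\<close> here and
      \<open>\<alpha> = e (Suc m)\<close> below annihilate the lowest and the highest term. Each
      costs one zero and one term, which keeps the count of the induction hypothesis.\<close>
    obtain Z1 where Z1: "finite Z1" "card Z1 = m" "Z1 \<subseteq> {0<..}"
      "\<forall>y\<in>Z1. (\<Sum>i\<le>Suc m. (c i * (e i - e 0)) * y powr e i) = 0"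
      using powr_sum_reduce_zeros[OF Suc.prems(2-5)] by blast
    obtain Z2 where Z2: "finite Z2" "card Z2 = m" "Z2 \<subseteq> {0<..}"
      "\<forall>y\<in>Z2. (\<Sum>i\<le>Suc m. (c i * (e i - e (Suc m))) * y powr e i) = 0"
      using powr_sum_reduce_zeros[OF Suc.prems(2-5)] by blast
    \<comment> \<open>The index of \<open>c1\<close> is shifted because the annihilated term has
      index 0.\<close>
    define c1 where "c1 i = c (Suc i) * (e (Suc i) - e 0)" for i
    define c2 where "c2 i = c i * (e i - e (Suc m))" for i
    have 1: "(\<forall>i\<le>m. c1 i = 0) \<or> (\<forall>i<m. c1 i * c1 (Suc i) < 0)"
    proof (rule Suc.IH[of "\<lambda>i. e (Suc i)" Z1])
      show "strict_mono_on {..m} (\<lambda>i. e (Suc i))" by (auto simp: strict_mono_on_def less)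
      show "\<forall>y\<in>Z1. (\<Sum>i\<le>m. c1 i * y powr e (Suc i)) = 0"
        using Z1(4) by (simp add: c1_def sum.atMost_Suc_shift del: sum.atMost_Suc)
    qed (use Z1 in auto)
    have 2: "(\<forall>i\<le>m. c2 i = 0) \<or> (\<forall>i<m. c2 i * c2 (Suc i) < 0)"
    proof (rule Suc.IH[of e Z2])
      show "strict_mono_on {..m} e" by (auto simp: strict_mono_on_def less)
      show "\<forall>y\<in>Z2. (\<Sum>i\<le>m. c2 i * y powr e i) = 0"
        using Z2(4) by (simp add: c2_def)
    qed (use Z2 in auto)
    have z1: "c1 i = 0 \<longleftrightarrow> c (Suc i) = 0" if "i \<le> m" for i
      using less[of 0 "Suc i"] that by (auto simp: c1_def)
    have z2: "c2 i = 0 \<longleftrightarrow> c i = 0" if "i \<le> m" for i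
      using less[of i "Suc m"] that by (auto simp: c2_def)
    \<comment> \<open>The two extra factors are both positive in \<open>n1\<close> and both negative
      in \<open>n2\<close>, so their product is positive either way.\<close>
    have n1: "c1 i * c1 (Suc i) < 0 \<longleftrightarrow> c (Suc i) * c (Suc (Suc i)) < 0" if "i < m" for i
      using less[of 0 "Suc i"] less[of 0 "Suc (Suc i)"] that
      by (auto simp: c1_def mult_less_0_iff zero_less_mult_iff)
    have n2: "c2 i * c2 (Suc i) < 0 \<longleftrightarrow> c i * c (Suc i) < 0" if "i < m" for i
      using less[of i "Suc m"] less[of "Suc i" "Suc m"] that
      by (auto simp: c2_def mult_less_0_iff zero_less_mult_iff)
    \<comment> \<open>The two ranges of indices overlap in \<open>1..m\<close>, so the alternatives cannot be mixed.\<close>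
    show ?thesis
    proof (cases "c 1 = 0")
      case True
      then have "c1 0 = 0" "c2 1 = 0" using z1[of 0] z2[of 1] False by auto
      then have "\<not> c1 0 * c1 (Suc 0) < 0" "\<not> c2 0 * c2 (Suc 0) < 0" by auto
      with 1 2 False have "\<forall>i\<le>m. c1 i = 0" "\<forall>i\<le>m. c2 i = 0" by blast+
      then have "c i = 0" if "i \<le> Suc m" for i
        using z1[of "i - 1"] z2[of 0] that by (cases i) auto
      then show ?thesis by blast
    next
      case nz: False
      then have "c1 0 \<noteq> 0" "c2 1 \<noteq> 0" using z1[of 0] z2[of 1] False by auto
      with 1 2 False have "\<forall>i<m. c1 i * c1 (Suc i) < 0" "\<forall>i<m. c2 i * c2 (Suc i) < 0"
        by (auto simp: Suc_le_eq)
      then have "c i * c (Suc i) < 0" if "i < Suc m" for i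
        using n1[of "i - 1"] n2[of 0] that False by (cases i) auto
      then show ?thesis by blast
    qed
  qed
qed

section \<open>Conics through points of a power curve\<close>

lemma sum_atMost_3: "(\<Sum>i\<le>3. f i) = f 0 + f 1 + f 2 + f (3::nat)"
  by (simp add: numeral_eq_Suc)

lemma sum_atMost_5: "(\<Sum>i\<le>5. f i) = f 0 + f 1 + f 2 + f 3 + f 4 + f (5::nat)"
  by (simp add: numeral_eq_Suc)

lemma sum_atMost_6: "(\<Sum>i\<le>6. f i) = f 0 + f 1 + f 2 + f 3 + f 4 + f 5 + f (6::nat)"
  by (simp add: numeral_eq_Suc)

text \<open>Reduces monotonicity of a concrete list of exponents to finitely many comparisons of
  neighbours.\<close>

lemma strict_mono_on_atMost_Suc:
  fixes e :: "nat \<Rightarrow> real"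
  assumes "\<And>i. i < m \<Longrightarrow> e i < e (Suc i)"
  shows "strict_mono_on {..m} e"
proof -
  have "e i < e j" if "i < j" "j \<le> m" for i j
    using that
  proof (induction j)
    case (Suc j)
    then show ?case using assms[of j] by (cases "i = j") auto
  qed simp
  then show ?thesis by (auto simp: strict_mono_on_def)
qed

text \<open>The monomials \<open>1\<close>, \<open>y\<close> and \<open>y\<^sup>2\<close> are
  written as real powers so that the equation is a sum of the six powers to which sign alternation
  applies.\<close>

lemma conic_on_power_curve:
  assumes "y > 0"
  shows "(a * y powr p, y) \<in> conic_points (A, B, C, D, E, F) \<longleftrightarrow>
    F * y powr 0 + E * y powr 1 + C * y powr 2 + (D * a) * y powr p
      + (B * a) * y powr (p + 1) + (A * a\<^sup>2) * y powr (2 * p) = 0"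
proof -
  have "y powr (2 * p) = (y powr p)\<^sup>2" using assms by (simp add: powr_power mult.commute)
  then show ?thesis using assms by (simp add: powr_add power_mult_distrib algebra_simps)
qed

text \<open>Six powers with five zeros are exactly the count of the alternation lemma; the factors
  \<open>a\<close> and \<open>a\<^sup>2\<close> are positive and leave the signs unchanged.\<close>

lemma conic_coeffs_alternate:
  fixes p a :: real
  assumes p: "p > 2" and a: "a > 0" and Y: "finite Y" "card Y = 5" "Y \<subseteq> {0<..}"
    and on: "\<forall>y\<in>Y. (a * y powr p, y) \<in> conic_points (A, B, C, D, E, F)"
    and nz: "is_conic (A, B, C, D, E, F)"
  shows "F * E < 0" "E * C < 0" "C * D < 0" "D * B < 0" "B * A < 0"
proof -
  define e where "e i = [0, 1, 2, p, p + 1, 2 * p] ! i" for i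
  define c where "c i = [F, E, C, D * a, B * a, A * a\<^sup>2] ! i" for i
  have sum_eq: "(\<Sum>i\<le>5. c i * y powr e i) =
      F * y powr 0 + E * y powr 1 + C * y powr 2 + (D * a) * y powr p
        + (B * a) * y powr (p + 1) + (A * a\<^sup>2) * y powr (2 * p)" for y
    unfolding sum_atMost_5 by (simp add: c_def e_def)
  have "strict_mono_on {..5} e"
    using p by (intro strict_mono_on_atMost_Suc)
      (auto simp: e_def less_Suc_eq numeral_eq_Suc)
  moreover have "\<forall>y\<in>Y. (\<Sum>i\<le>5. c i * y powr e i) = 0"
    using on Y(3) conic_on_power_curve[of _ a p A B C D E F]
    by (simp only: sum_eq) blast
  ultimately have alt: "(\<forall>i\<le>5. c i = 0) \<or> (\<forall>i<5. c i * c (Suc i) < 0)"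
    using powr_sum_sign_alternation[of 5 e Y c] Y by blast
  have "\<not> (\<forall>i\<le>5. c i = 0)"
  proof
    assume *: "\<forall>i\<le>5. c i = 0"
    have "F = 0" "E = 0" "C = 0" "D = 0" "B = 0" "A = 0"
      using *[rule_format, of 0] *[rule_format, of 1] *[rule_format, of 2]
        *[rule_format, of 3] *[rule_format, of 4] *[rule_format, of 5] a
      by (auto simp: c_def)
    with nz show False by (simp add: is_conic_def zero_prod_def)
  qed
  with alt have *: "\<forall>i<5. c i * c (Suc i) < 0" by blast
  show "F * E < 0" "E * C < 0" "C * D < 0" "D * B < 0" "B * A < 0"
    using *[rule_format, of 0] *[rule_format, of 1] *[rule_format, of 2]
        *[rule_format, of 3] *[rule_format, of 4] a
    by (auto simp: c_def mult_less_0_iff zero_less_mult_iff)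
qed

section \<open>Degenerate conics and lines\<close>

text \<open>Serves to count the curve points on the two lines of a degenerate conic, where \<gamma>
  is \<open>2 * A\<close> and hence nonzero.\<close>

lemma line_meets_power_curve:
  fixes p a :: real
  assumes p: "p > 2" and a: "a > 0" and "\<gamma> \<noteq> 0"
  shows "finite {y\<in>{0<..}. \<alpha> + \<beta> * y + \<gamma> * (a * y powr p) = 0} \<and>
    card {y\<in>{0<..}. \<alpha> + \<beta> * y + \<gamma> * (a * y powr p) = 0} \<le> 2" (is "finite ?L \<and> card ?L \<le> 2")
proof (rule ccontr)
  assume "\<not> ?thesis"
  then have "infinite ?L \<or> 3 \<le> card ?L" by auto
  then obtain Z where Z: "Z \<subseteq> ?L" "finite Z" "card Z = 3"
    by (metis (lifting) infinite_arbitrarily_large obtain_subset_with_card_n)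
  \<comment> \<open>The spurious term \<open>0 \<cdot> y\<^sup>2\<close> makes three zeros violate the alternation.\<close>
  define e where "e i = [0, 1, 2, p] ! i" for i
  define c where "c i = [\<alpha>, \<beta>, 0, \<gamma> * a] ! i" for i
  have "strict_mono_on {..3} e"
    using p by (intro strict_mono_on_atMost_Suc)
      (auto simp: e_def less_Suc_eq numeral_eq_Suc)
  moreover have "\<forall>y\<in>Z. (\<Sum>i\<le>3. c i * y powr e i) = 0"
    using Z(1) unfolding sum_atMost_3 by (auto simp: c_def e_def)
  moreover have "Z \<subseteq> {0<..}" using Z(1) by auto
  ultimately have "(\<forall>i\<le>3. c i = 0) \<or> (\<forall>i<3. c i * c (Suc i) < 0)"
    using powr_sum_sign_alternation[of 3 e Z c] Z by blast
  moreover have "c 3 \<noteq> 0" "c 2 = 0" using assms by (auto simp: c_def)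
  ultimately have "c 1 * c (Suc 1) < 0" by auto
  then show False by (simp add: c_def)
qed

text \<open>The factor 4 clears the halves in the off-diagonal entries.\<close>

lemma det_conic_matrix:
  "4 * det (conic_matrix (A, B, C, D, E, F)) =
     4 * A * C * F + B * D * E - A * E\<^sup>2 - C * D\<^sup>2 - F * B\<^sup>2"
  by (simp add: det_3 vector_3 power2_eq_square field_simps)

text \<open>
  Completing the square in \<open>u\<close> leaves a quadratic in \<open>y\<close> with leading coefficient the
  discriminant of the conic; its own discriminant is a multiple of the determinant.
\<close>

lemma degenerate_hyperbola_splits:
  fixes A B C D E F :: real
  assumes "det (conic_matrix (A, B, C, D, E, F)) = 0"
    and disc: "conic_discriminant (A, B, C, D, E, F) > 0"
    and "A \<noteq> 0"
  obtains \<beta> \<alpha> \<beta>' \<alpha>' where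
    "\<And>u y. (u, y) \<in> conic_points (A, B, C, D, E, F) \<Longrightarrow>
       \<alpha> + \<beta> * y + 2 * A * u = 0 \<or> \<alpha>' + \<beta>' * y + 2 * A * u = 0"
proof -
  define d where "d = B\<^sup>2 - 4 * A * C"
  define w where "w = sqrt d"
  \<comment> \<open>\<open>(2 * A * u + B * y + D)\<^sup>2\<close> minus \<open>4 * A\<close> times
    the conic polynomial is to become \<open>(w * y + k)\<^sup>2\<close>; comparing the coefficients
    of \<open>y\<close> forces this \<open>k\<close>.\<close>
  define k where "k = (B * D - 2 * A * E) / w"
  have "d > 0" using disc by (simp add: d_def)
  then have w: "w > 0" "w\<^sup>2 = d" by (auto simp: w_def)
  have wk: "w * k = B * D - 2 * A * E" using w by (simp add: k_def)
  have det: "4 * A * C * F + B * D * E - A * E\<^sup>2 - C * D\<^sup>2 - F * B\<^sup>2 = 0"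
    using assms(1) det_conic_matrix[of A B C D E F] by simp
  have "w\<^sup>2 * k\<^sup>2 = w\<^sup>2 * (D\<^sup>2 - 4 * A * F)"
  proof -
    have "w\<^sup>2 * k\<^sup>2 = (B * D - 2 * A * E)\<^sup>2" by (simp add: wk[symmetric] power_mult_distrib)
    also have "\<dots> = d * (D\<^sup>2 - 4 * A * F)"
      using det unfolding d_def by algebra
    finally show ?thesis by (simp add: w)
  qed
  then have k2: "k\<^sup>2 = D\<^sup>2 - 4 * A * F" using w(1) by simp
  show thesis
  proof (rule that[of "D + k" "B + w" "D - k" "B - w"])
    fix u y assume "(u, y) \<in> conic_points (A, B, C, D, E, F)"
    then have q: "F + E * y + C * y\<^sup>2 + D * u + B * u * y + A * u\<^sup>2 = 0" by simp
    have "((D + k) + (B + w) * y + 2 * A * u) * ((D - k) + (B - w) * y + 2 * A * u) =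
      (2 * A * u + B * y + D)\<^sup>2 - (w\<^sup>2 * y\<^sup>2 + 2 * (w * k) * y + k\<^sup>2)"
      by (simp add: power2_eq_square algebra_simps)
    also have "\<dots> = 4 * A * (F + E * y + C * y\<^sup>2 + D * u + B * u * y + A * u\<^sup>2)"
      unfolding w(2) wk k2 d_def by (simp add: power2_eq_square algebra_simps)
    finally show "D + k + (B + w) * y + 2 * A * u = 0 \<or> D - k + (B - w) * y + 2 * A * u = 0"
      using q by simp
  qed
qed

section \<open>The conic through five points of the curve\<close>

text \<open>At most five linear conditions on six coefficients leave a nonzero solution.\<close>

lemma conic_through_five_points_exists:
  fixes P :: "(real \<times> real) set"
  assumes "finite P" "card P \<le> 5"
  obtains q where "is_conic q" "P \<subseteq> conic_points q"
proof -
  \<comment> \<open>The Veronese map, with monomials in the order of the coefficients: a point lies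
    on \<open>q\<close> exactly when its image is orthogonal to \<open>q\<close>.\<close>
  define v :: "real \<times> real \<Rightarrow> conic_eqn" where
    "v = (\<lambda>(u, y). (u\<^sup>2, u * y, y\<^sup>2, u, y, 1))"
  have "dim (v ` P) \<le> card (v ` P)" using assms by (intro dim_le_card') auto
  also have "\<dots> \<le> 5" using card_image_le[OF assms(1), of v] assms(2) by linarith
  also have "\<dots> < DIM(conic_eqn)" by simp
  finally obtain q where q: "q \<noteq> 0" "\<And>x. x \<in> span (v ` P) \<Longrightarrow> orthogonal q x"
    using orthogonal_to_subspace_exists by metis
  obtain A B C D E F where q_eq: "q = (A, B, C, D, E, F)" by (cases q) auto
  have "x \<in> conic_points q" if "x \<in> P" for x
  proof -
    have "orthogonal q (v x)" using that by (intro q(2) span_base imageI)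
    then show ?thesis by (cases x) (simp add: q_eq v_def orthogonal_def algebra_simps)
  qed
  then show thesis using q(1) by (intro that[of q]) (auto simp: is_conic_def)
qed

lemma five_points_determine_hyperbola:
  fixes p a :: real
  assumes p: "p > 2" and a: "a > 0" and r: "0 < r"
    and P: "P \<subseteq> power_arc p a r s" "card P = 5"
  shows "determines_nondegenerate_hyperbola P"
proof -
  define Y where "Y = snd ` P"
  have finP: "finite P" using P(2) by (intro card_ge_0_finite) simp
  have P_eq: "x = (a * snd x powr p, snd x)" "snd x > 0" if "x \<in> P" for x
    using P(1) r that by (auto simp: power_arc_def)
  have "inj_on snd P" using P_eq(1) by (intro inj_onI) metis
  then have Y: "finite Y" "card Y = 5" "Y \<subseteq> {0<..}"
    using finP P(2) P_eq(2) by (auto simp: Y_def card_image)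
  have on: "\<forall>y\<in>Y. (a * y powr p, y) \<in> conic_points q" if "P \<subseteq> conic_points q" for q
    using that P_eq(1) by (fastforce simp: Y_def)
  obtain q where q: "is_conic q" "P \<subseteq> conic_points q"
    using conic_through_five_points_exists[OF finP] P(2) by (metis order_refl)
  obtain A B C D E F where q_eq: "q = (A, B, C, D, E, F)" by (cases q) auto
  note alt = conic_coeffs_alternate[OF p a Y on[OF q(2), unfolded q_eq] q(1)[unfolded q_eq]]
  have disc: "conic_discriminant q > 0"
  proof -
    \<comment> \<open>In the list \<open>F, E, C, D, B, A\<close> of alternating signs,
      \<open>C\<close> and \<open>A\<close> are three places apart, hence of opposite sign.\<close>
    have "A * C < 0" using alt by (auto simp: mult_less_0_iff)
    then have "0 < B\<^sup>2 - 4 * (A * C)" using zero_le_power2[of B] by linarith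
    then show ?thesis by (simp add: q_eq mult.assoc)
  qed
  have uniq: "same_conic q q'" if q': "is_conic q'" "P \<subseteq> conic_points q'" for q'
  proof -
    obtain A' B' C' D' E' F' where q'_eq: "q' = (A', B', C', D', E', F')" by (cases q') auto
    note alt' = conic_coeffs_alternate[OF p a Y on[OF q'(2), unfolded q'_eq] q'(1)[unfolded q'_eq]]
    have F: "F \<noteq> 0" "F' \<noteq> 0" using alt alt' by auto
    \<comment> \<open>This \<open>k\<close> makes the constant term of
      \<open>q' - k *\<^sub>R q\<close> vanish. The difference still passes through the five points,
      so strict alternation would be violated unless it is zero.\<close>
    define k where "k = F' / F"
    have "k \<noteq> 0" "F' = k * F" using F by (auto simp: k_def)
    let ?q = "(A' - k * A, B' - k * B, C' - k * C, D' - k * D, E' - k * E, F' - k * F)"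
    have "\<forall>y\<in>Y. (a * y powr p, y) \<in> conic_points ?q"
    proof
      fix y assume "y \<in> Y"
      define u where "u = a * y powr p"
      have "F + E * y + C * y\<^sup>2 + D * u + B * u * y + A * u\<^sup>2 = 0"
        "F' + E' * y + C' * y\<^sup>2 + D' * u + B' * u * y + A' * u\<^sup>2 = 0"
        using on[OF q(2)] on[OF q'(2)] \<open>y \<in> Y\<close> by (auto simp: q_eq q'_eq u_def)
      then have "(u, y) \<in> conic_points ?q" by (simp, algebra)
      then show "(a * y powr p, y) \<in> conic_points ?q" by (simp only: u_def)
    qed
    from conic_coeffs_alternate(1)[OF p a Y this] \<open>F' = k * F\<close>
    have "\<not> is_conic ?q" by auto
    then have "q' = k *\<^sub>R q" by (simp add: is_conic_def zero_prod_def q_eq q'_eq)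
    with \<open>k \<noteq> 0\<close> show ?thesis by (auto simp: same_conic_def)
  qed
  have "det (conic_matrix q) \<noteq> 0"
  proof
    assume 0: "det (conic_matrix q) = 0"
    have A: "A \<noteq> 0" using alt by auto
    obtain \<beta> \<alpha> \<beta>' \<alpha>' where lines: "\<And>u y. (u, y) \<in> conic_points (A, B, C, D, E, F) \<Longrightarrow>
       \<alpha> + \<beta> * y + 2 * A * u = 0 \<or> \<alpha>' + \<beta>' * y + 2 * A * u = 0"
      using degenerate_hyperbola_splits 0 disc A unfolding q_eq by metis
    define L where "L \<alpha> \<beta> = {y\<in>{0<..}. \<alpha> + \<beta> * y + 2 * A * (a * y powr p) = 0}" for \<alpha> \<beta>
    have L: "finite (L \<alpha> \<beta>)" "card (L \<alpha> \<beta>) \<le> 2" for \<alpha> \<beta>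
      using line_meets_power_curve[OF p a, of "2 * A" \<alpha> \<beta>] A by (auto simp: L_def)
    have "Y \<subseteq> L \<alpha> \<beta> \<union> L \<alpha>' \<beta>'"
      using lines on[OF q(2)] Y(3) unfolding q_eq L_def by blast
    then have "card Y \<le> card (L \<alpha> \<beta> \<union> L \<alpha>' \<beta>')" using L by (intro card_mono) auto
    also have "\<dots> \<le> card (L \<alpha> \<beta>) + card (L \<alpha>' \<beta>')" by (rule card_Un_le)
    also have "\<dots> \<le> 4" using L(2)[of \<alpha> \<beta>] L(2)[of \<alpha>' \<beta>'] by linarith
    finally show False using Y(2) by simp
  qed
  then have "nondegenerate_hyperbola q"
    using q(1) disc by (simp add: nondegenerate_hyperbola_def nondegenerate_conic_def invertible_det_nz)
  with q uniq show ?thesis unfolding determines_nondegenerate_hyperbola_def by blast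
qed

section \<open>No conic contains the arc\<close>

text \<open>Six points of the arc suffice: a seventh term with coefficient 0 brings six zeros into
  the scope of the alternation lemma and excludes strict alternation, so all coefficients
  vanish.\<close>

lemma nonconic_power_arc:
  fixes p a r s :: real
  assumes p: "p > 2" and a: "a > 0" and r: "0 < r" "r < s"
  shows "nonconic (power_arc p a r s)"
  unfolding nonconic_def
proof clarify
  fix A B C D E F
  assume nz: "is_conic (A, B, C, D, E, F)"
    and sub: "power_arc p a r s \<subseteq> conic_points (A, B, C, D, E, F)"
  obtain Y where Y: "Y \<subseteq> {r..s}" "finite Y" "card Y = 6"
    using infinite_arbitrarily_large[OF infinite_Icc[OF r(2)], of 6] by auto
  have on: "(a * y powr p, y) \<in> conic_points (A, B, C, D, E, F)" if "y \<in> Y" for y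
  proof -
    have "(a * y powr p, y) \<in> power_arc p a r s" using Y(1) that by (auto simp: power_arc_def)
    then show ?thesis using sub by blast
  qed
  \<comment> \<open>The last exponent \<open>2 * p + 1\<close> stands for any number above
    \<open>2 * p\<close>; it carries the coefficient 0.\<close>
  define e where "e i = [0, 1, 2, p, p + 1, 2 * p, 2 * p + 1] ! i" for i
  define c where "c i = [F, E, C, D * a, B * a, A * a\<^sup>2, 0] ! i" for i
  have sum_eq: "(\<Sum>i\<le>6. c i * y powr e i) =
      F * y powr 0 + E * y powr 1 + C * y powr 2 + (D * a) * y powr p
        + (B * a) * y powr (p + 1) + (A * a\<^sup>2) * y powr (2 * p)" for y
    unfolding sum_atMost_6 by (simp add: c_def e_def)
  have "strict_mono_on {..6} e"
    using p by (intro strict_mono_on_atMost_Suc)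
      (auto simp: e_def less_Suc_eq numeral_eq_Suc)
  moreover have pos: "Y \<subseteq> {0<..}" using Y r by auto
  moreover have "\<forall>y\<in>Y. (\<Sum>i\<le>6. c i * y powr e i) = 0"
    using on pos conic_on_power_curve[of _ a p A B C D E F]
    by (simp only: sum_eq) blast
  ultimately have "(\<forall>i\<le>6. c i = 0) \<or> (\<forall>i<6. c i * c (Suc i) < 0)"
    using powr_sum_sign_alternation[of 6 e Y c] Y by blast
  moreover have "\<not> c 5 * c (Suc 5) < 0" by (simp add: c_def)
  moreover have "(5::nat) < 6" by simp
  ultimately have *: "\<forall>i\<le>6. c i = 0" by blast
  have "F = 0" "E = 0" "C = 0" "D = 0" "B = 0" "A = 0"
    using *[rule_format, of 0] *[rule_format, of 1] *[rule_format, of 2]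
      *[rule_format, of 3] *[rule_format, of 4] *[rule_format, of 5] a
    by (auto simp: c_def)
  with nz show False by (simp add: is_conic_def zero_prod_def)
qed

section \<open>The power arc as a path\<close>

definition power_path :: "real \<Rightarrow> real \<Rightarrow> real \<Rightarrow> real \<Rightarrow> real \<Rightarrow> real \<times> real" where
  "power_path p a r s t = (a * (r + t * (s - r)) powr p, r + t * (s - r))"

lemma path_image_power_path:
  assumes "r < s"
  shows "path_image (power_path p a r s) = power_arc p a r s"
proof -
  have "(\<lambda>t. r + t * (s - r)) ` {0..1} = {r..s}"
  proof -
    have "(\<lambda>t. r + t * (s - r)) ` {0..1} = closed_segment r s"
      by (simp add: closed_segment_image_interval algebra_simps)
    then show ?thesis using assms by (simp add: closed_segment_eq_real_ivl)
  qed
  then have "power_path p a r s ` {0..1} = (\<lambda>y. (a * y powr p, y)) ` {r..s}"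
    unfolding power_path_def by (metis (no_types, lifting) image_cong image_image)
  then show ?thesis by (auto simp: path_image_def power_arc_def)
qed

lemma arc_power_path:
  assumes "0 < r" "r < s"
  shows "arc (power_path p a r s)"
proof -
  have "0 < r + t * (s - r)" if "t \<in> {0..1}" for t
    using that assms by (intro add_pos_nonneg) auto
  then have "path (power_path p a r s)"
    unfolding path_def power_path_def by (intro continuous_intros) fastforce+
  moreover have "inj_on (power_path p a r s) {0..1}"
    using assms by (auto simp: inj_on_def power_path_def)
  ultimately show ?thesis by (simp add: arc_def)
qed

text \<open>Regularity comes from the second coordinate, whose derivative is the constant
  \<open>s - r\<close>.\<close>

lemma has_vector_derivative_power_path:
  assumes "0 < r + t * (s - r)" "r < s"
  shows "\<exists>v. v \<noteq> 0 \<and> (power_path p a r s has_vector_derivative v) (at t)"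
proof -
  have "((\<lambda>t. a * (r + t * (s - r)) powr p) has_real_derivative
      a * (p * (r + t * (s - r)) powr (p - 1) * (s - r))) (at t)"
    using assms by (auto intro!: derivative_eq_intros)
  moreover have "((\<lambda>t. r + t * (s - r)) has_real_derivative s - r) (at t)"
    by (auto intro!: derivative_eq_intros)
  ultimately have "(power_path p a r s has_vector_derivative
      (a * (p * (r + t * (s - r)) powr (p - 1) * (s - r)), s - r)) (at t)"
    unfolding power_path_def has_real_derivative_iff_has_vector_derivative
    by (rule has_vector_derivative_Pair)
  then show ?thesis using assms by (intro exI conjI) (auto simp: zero_prod_def)
qed

text \<open>Factoring \<open>z powr p\<close> out of \<open>(z + h * d) powr p\<close> leaves a
  binomial series in \<open>h * d / z\<close>; the second coordinate is affine in
  \<open>h\<close>.\<close>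

lemma real_analytic_at_power_path:
  assumes "0 < r + t * (s - r)" "r < s"
  shows "real_analytic_at (power_path p a r s) t"
  unfolding real_analytic_at_def
proof (intro exI conjI allI impI)
  define z where "z = r + t * (s - r)"
  define d where "d = s - r"
  define c1 where "c1 n = a * z powr p * ((p gchoose n) * (d / z) ^ n)" for n
  define c2 where "c2 n = (if n = 0 then z else if n = 1 then d else 0)" for n :: nat
  have z: "z > 0" and d: "d > 0" using assms by (auto simp: z_def d_def)
  \<comment> \<open>The radius \<open>z / d\<close> expresses the convergence condition
    \<open>\<bar>h * d / z\<bar> < 1\<close> of the binomial series.\<close>
  show "0 < z / d" using z d by simp
  fix h :: real assume h: "\<bar>h\<bar> < z / d"
  have lt: "\<bar>h * d / z\<bar> < 1" using h z d by (simp add: abs_mult field_simps)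
  have "(\<lambda>n. (p gchoose n) * (h * d / z) ^ n) sums (1 + h * d / z) powr p"
    using gen_binomial_real[OF lt] .
  then have "(\<lambda>n. a * z powr p * ((p gchoose n) * (h * d / z) ^ n)) sums
      (a * z powr p * (1 + h * d / z) powr p)" by (rule sums_mult)
  moreover have "z powr p * (1 + h * d / z) powr p = (z + h * d) powr p"
  proof -
    have "0 \<le> 1 + h * d / z" using lt by linarith
    then have "z powr p * (1 + h * d / z) powr p = (z * (1 + h * d / z)) powr p"
      using z by (simp add: powr_mult)
    also have "z * (1 + h * d / z) = z + h * d" using z by (simp add: field_simps)
    finally show ?thesis .
  qed
  ultimately have 1: "(\<lambda>n. h ^ n * c1 n) sums (a * (z + h * d) powr p)"
    by (simp add: c1_def power_mult_distrib power_divide mult_ac)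
  have "(\<lambda>n. h ^ n * c2 n) sums (\<Sum>n\<in>{0,1}. h ^ n * c2 n)"
    by (rule sums_finite) (auto simp: c2_def)
  then have 2: "(\<lambda>n. h ^ n * c2 n) sums (z + h * d)" by (simp add: c2_def)
  have "(\<lambda>n. (h ^ n * c1 n, h ^ n * c2 n)) sums (a * (z + h * d) powr p, z + h * d)"
    using tendsto_Pair[OF 1[unfolded sums_def] 2[unfolded sums_def]]
    by (simp add: sums_def sum_prod)
  then show "(\<lambda>n. h ^ n *\<^sub>R (c1 n, c2 n)) sums power_path p a r s (t + h)"
    by (simp add: power_path_def z_def d_def algebra_simps)
qed

section \<open>Rectifiability\<close>

text \<open>A chord is at most the sum of its coordinate increments; by monotonicity these are
  nonnegative and telescope to at most the total increments over \<open>{0..1}\<close>.\<close>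

lemma finite_length_monotone_components:
  fixes f g :: "real \<Rightarrow> real"
  assumes f: "mono_on {0..1} f" and g: "mono_on {0..1} g"
  shows "finite_length (\<lambda>t. (f t, g t))"
  unfolding finite_length_def
proof (rule bdd_aboveI[of _ "(f 1 - f 0) + (g 1 - g 0)"], clarify)
  fix n and t :: "nat \<Rightarrow> real"
  assume t: "\<forall>i\<le>n. t i \<in> {0..1}" "mono_on {..n} t"
  have step: "dist (f (t i), g (t i)) (f (t (Suc i)), g (t (Suc i))) \<le>
      (f (t (Suc i)) - f (t i)) + (g (t (Suc i)) - g (t i))" if "i < n" for i
  proof -
    have "t i \<le> t (Suc i)" using t(2) that by (auto simp: mono_on_def)
    moreover have "t i \<in> {0..1}" "t (Suc i) \<in> {0..1}" using t(1) that by auto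
    ultimately have "f (t i) \<le> f (t (Suc i))" "g (t i) \<le> g (t (Suc i))"
      using f g by (auto simp: mono_on_def)
    then show ?thesis
      using sqrt_sum_squares_le_sum_abs[of "f (t i) - f (t (Suc i))" "g (t i) - g (t (Suc i))"]
      by (simp add: dist_Pair_Pair dist_real_def power2_commute)
  qed
  have "(\<Sum>i<n. dist (f (t i), g (t i)) (f (t (Suc i)), g (t (Suc i)))) \<le>
      (\<Sum>i<n. (f (t (Suc i)) - f (t i)) + (g (t (Suc i)) - g (t i)))"
    using step by (intro sum_mono) auto
  also have "\<dots> = (f (t n) - f (t 0)) + (g (t n) - g (t 0))"
    unfolding sum.distrib
    by (simp only: sum_lessThan_telescope[of "\<lambda>i. f (t i)"] sum_lessThan_telescope[of "\<lambda>i. g (t i)"])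
  also have "\<dots> \<le> (f 1 - f 0) + (g 1 - g 0)"
  proof -
    have "t n \<in> {0..1}" "t 0 \<in> {0..1}" using t(1) by auto
    then have "f (t n) \<le> f 1" "f 0 \<le> f (t 0)" "g (t n) \<le> g 1" "g 0 \<le> g (t 0)"
      using f g by (auto simp: mono_on_def)
    then show ?thesis by linarith
  qed
  finally show "(\<Sum>i<n. dist (f (t i), g (t i)) (f (t (Suc i)), g (t (Suc i)))) \<le>
      (f 1 - f 0) + (g 1 - g 0)" .
qed

lemma finite_length_power_path:
  assumes "0 \<le> p" "0 \<le> a" "0 < r" "r < s"
  shows "finite_length (power_path p a r s)"
proof -
  have mono: "mono_on {0..1} (\<lambda>t. r + t * (s - r))"
    using assms by (auto simp: mono_on_def intro: mult_right_mono)
  moreover have "mono_on {0..1} (\<lambda>t. a * (r + t * (s - r)) powr p)"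
    using assms mono by (auto simp: mono_on_def intro!: mult_left_mono powr_mono2)
  ultimately show ?thesis
    using finite_length_monotone_components unfolding power_path_def by blast
qed

theorem corollary6:
  fixes p a r s :: real
  assumes "p > 2" and "a > 0" and "0 < r" and "r < s"
  shows "nonconic (power_arc p a r s) \<and>
         real_analytic_arc (power_arc p a r s) \<and>
         rectifiable_arc (power_arc p a r s) \<and>
         (\<forall>P. P \<subseteq> power_arc p a r s \<and> card P = 5 \<longrightarrow>
              determines_nondegenerate_hyperbola P)"
proof (intro conjI allI impI)
  have pos: "0 < r + t * (s - r)" if "t \<in> {0..1}" for t
    using that assms by (intro add_pos_nonneg) auto
  have arc: "arc (power_path p a r s)" "path_image (power_path p a r s) = power_arc p a r s"
    using assms arc_power_path path_image_power_path by auto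
  show "nonconic (power_arc p a r s)" using assms by (rule nonconic_power_arc)
  show "real_analytic_arc (power_arc p a r s)"
    unfolding real_analytic_arc_def
    using arc real_analytic_at_power_path has_vector_derivative_power_path pos assms(4) by blast
  show "rectifiable_arc (power_arc p a r s)"
    unfolding rectifiable_arc_def
    using arc finite_length_power_path[of p a r s] assms by auto
  show "determines_nondegenerate_hyperbola P"
    if "P \<subseteq> power_arc p a r s \<and> card P = 5" for P
    using five_points_determine_hyperbola[of p a r P s] assms that by blast
qed

end
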